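(* Let $d\ge 2$, $p\ge 1$, and let $C>0$ be admissible. Then $\mathrm{DSW}_p(\cdot,\cdot;C)$ is a well-defined metric on $\mathcal{P}_p(\mathbb{R}^d)$, the space of Borel probability measures on $\mathbb{R}^d$ with finite $p$-th moment. In particular, for all $\mu,\nu,\eta\in\mathcal{P}_p(\mathbb{R}^d)$: $\mathrm{DSW}_p(\mu,\nu;C)\ge 0$; $\mathrm{DSW}_p(\mu,\nu;C)=\mathrm{DSW}_p(\nu,\mu;C)$; $\mathrm{DSW}_p(\mu,\nu;C)=0$ if and only if $\mu=\nu$; and $\mathrm{DSW}_p(\mu,\nu;C)\le \mathrm{DSW}_p(\mu,\eta;C)+\mathrm{DSW}_p(\eta,\nu;C)$.
   Context: $\mathbb{S}^{d-1}$ is the unit sphere of $\mathbb{R}^d$ in the Euclidean norm. For a Borel probability measure $\mu$ on $\mathbb{R}^d$ and $\theta\in\mathbb{S}^{d-1}$, let $\mathcal{R}\mu(\cdot,\theta)$ denote the one-dimensional probability measure obtained as the pushforward of $\mu$ under $x\mapsto\langle x,\theta\rangle$ (the Radon transform of $\mu$ in direction $\theta$). $W_p$ denotes the Wasserstein distance of order $p$ (with Euclidean ground cost). A constant $C>0$ is called admissible if the set $\mathbb{M}_C$ of Borel probability measures $\sigma$ on $\mathbb{S}^{d-1}$ satisfying $\mathbb{E}_{\theta,\theta'\sim\sigma}[|\theta^\top\theta'|]\le C$ (with $\theta,\theta'$ independent) is nonempty. For admissible $C$, the distributional sliced-Wasserstein distance is $$\mathrm{DSW}_p(\mu,\nu;C)=\sup_{\sigma\in\mathbb{M}_C}\Big(\mathbb{E}_{\theta\sim\sigma}\big[W_p^p(\mathcal{R}\mu(\cdot,\theta),\mathcal{R}\nu(\cdot,\theta))\big]\Big)^{1/p}.$$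 *)

theory Defs
  imports "HOL-Probability.Probability"
begin

definition radon :: "'a::euclidean_space measure \<Rightarrow> 'a \<Rightarrow> real measure" where
  "radon \<mu> \<theta> = distr \<mu> borel (\<lambda>x. x \<bullet> \<theta>)"

definition couplings :: "real measure \<Rightarrow> real measure \<Rightarrow> (real \<times> real) measure set" where
  "couplings \<mu> \<nu> = {\<pi>. sets \<pi> = sets (borel \<Otimes>\<^sub>M borel) \<and> prob_space \<pi> \<and>
      distr \<pi> borel fst = \<mu> \<and> distr \<pi> borel snd = \<nu>}"

definition Wpp :: "real \<Rightarrow> real measure \<Rightarrow> real measure \<Rightarrow> ennreal" where
  "Wpp p \<mu> \<nu> = (INF \<pi>\<in>couplings \<mu> \<nu>. \<integral>\<^sup>+ z. ennreal (\<bar>fst z - snd z\<bar> powr p) \<partial>\<pi>)"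

definition Pp :: "real \<Rightarrow> 'a::euclidean_space measure set" where
  "Pp p = {\<mu>. sets \<mu> = sets borel \<and> prob_space \<mu> \<and>
            (\<integral>\<^sup>+ x. ennreal (norm x powr p) \<partial>\<mu>) < \<infinity>}"

text \<open>The set M_C: Borel probability measures on the unit sphere (represented as Borel
  probability measures on R^d with full mass on the sphere) with
  E_{theta,theta' ~ sigma independent} |theta . theta'| <= C.\<close>
definition MC :: "real \<Rightarrow> 'a::euclidean_space measure set" where
  "MC C = {\<sigma>. sets \<sigma> = sets borel \<and> prob_space \<sigma> \<and> emeasure \<sigma> (sphere 0 1) = 1 \<and>
            (\<integral>\<^sup>+ z. ennreal \<bar>fst z \<bullet> snd z\<bar> \<partial>(\<sigma> \<Otimes>\<^sub>M \<sigma>)) \<le> ennreal C}"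

definition DSWpp :: "real \<Rightarrow> real \<Rightarrow> 'a::euclidean_space measure \<Rightarrow> 'a measure \<Rightarrow> ennreal" where
  "DSWpp p C \<mu> \<nu> = (SUP \<sigma>\<in>MC C. \<integral>\<^sup>+ \<theta>. Wpp p (radon \<mu> \<theta>) (radon \<nu> \<theta>) \<partial>\<sigma>)"

text \<open>The distributional sliced-Wasserstein distance (meaningful when DSWpp is finite).\<close>
definition DSW :: "real \<Rightarrow> real \<Rightarrow> 'a::euclidean_space measure \<Rightarrow> 'a measure \<Rightarrow> real" where
  "DSW p C \<mu> \<nu> = (enn2real (DSWpp p C \<mu> \<nu>)) powr (1 / p)"

end

theory Submission
  imports Defs
begin

text \<open>
  Couplings are glued approximately: after rounding the shared coordinate to cells of size \<open>e\<close>, only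
  the countably many cells have to be matched, which needs no disintegration and costs only \<open>e\<close> in
  the triangle inequality for \<open>W_p\<close>. Combined with the Lipschitz dependence of the projections on the
  direction, this makes the sliced distance continuous in \<open>\<theta>\<close>, so Minkowski's inequality for each
  \<open>\<sigma>\<close> yields the triangle inequality for \<open>DSW\<close>.

  For definiteness, every \<open>\<sigma>\<close> on the sphere has energy at least \<open>1/d\<close> because \<open>|t| \<ge> t\<^sup>2\<close>
  there and the second moment matrix of \<open>\<sigma>\<close> has trace \<open>1\<close>; the uniform measure on an orthonormal
  basis attains this value. Hence, as soon as \<open>MC C\<close> is nonempty, it contains all these measures, and
  together they charge every direction.
  If \<open>DSW\<close> vanishes, all projections therefore agree, and the theorem of Cramer and Wold applies.
\<close>

subsection \<open>Integral inequalities\<close>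

text \<open>For two positive points this is the convexity of \<open>powr\<close>; if one point is
  zero, it reduces to \<open>a powr p \<le> a\<close> for \<open>0 < a \<le> 1\<close>.\<close>

lemma powr_convex_combination:
  fixes p u v x y :: real
  assumes "p \<ge> 1" "u > 0" "v > 0" "u + v = 1" "x \<ge> 0" "y \<ge> 0"
  shows "(u * x + v * y) powr p \<le> u * x powr p + v * y powr p"
proof -
  have small: "(a * z) powr p \<le> a * z powr p" if "0 < a" "a \<le> 1" "z \<ge> 0" for a z :: real
  proof -
    have "a powr p \<le> a powr 1"
      using that \<open>p \<ge> 1\<close> by (intro powr_mono') auto
    with that show ?thesis
      by (simp add: powr_mult mult_right_mono)
  qed
  consider "x = 0" | "y = 0" | "x > 0" "y > 0" using assms by linarith
  then show ?thesis
  proof cases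
    case 3
    then show ?thesis
      using convex_onD[OF powr_convex[OF \<open>p \<ge> 1\<close>], of v x y] assms
      by (simp add: eq_diff_eq[symmetric])
  qed (use small[of u x] small[of v y] assms in auto)
qed

text \<open>Minkowski's inequality by normalisation: \<open>f / a\<close> and \<open>g / b\<close>
  have p-th moments at most 1, and \<open>(f + g) / (a + b)\<close> is a convex combination of them,
  so pointwise convexity can be integrated. Positive upper bounds \<open>a\<close>, \<open>b\<close>
  take the place of the norms, so that division by them is possible.\<close>

lemma nn_integral_Minkowski:
  fixes f g :: "'a \<Rightarrow> real"
  assumes "p \<ge> 1" and [measurable]: "f \<in> borel_measurable M" "g \<in> borel_measurable M"
    and nonneg: "\<And>x. f x \<ge> 0" "\<And>x. g x \<ge> 0" and pos: "a > 0" "b > 0"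
    and f: "(\<integral>\<^sup>+x. ennreal (f x powr p) \<partial>M) \<le> ennreal (a powr p)"
    and g: "(\<integral>\<^sup>+x. ennreal (g x powr p) \<partial>M) \<le> ennreal (b powr p)"
  shows "(\<integral>\<^sup>+x. ennreal ((f x + g x) powr p) \<partial>M) \<le> ennreal ((a + b) powr p)"
proof -
  \<comment> \<open>The weights collect the factors left after pulling \<open>a + b\<close> out of
    the convex combination; they satisfy
    \<open>u * a powr p + v * b powr p = (a + b) powr p\<close>.\<close>
  define u where "u = (a + b) powr p * (a / (a + b)) / a powr p"
  define v where "v = (a + b) powr p * (b / (a + b)) / b powr p"
  have uv: "u \<ge> 0" "v \<ge> 0" using pos by (simp_all add: u_def v_def)
  have le: "(f x + g x) powr p \<le> u * f x powr p + v * g x powr p" for x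
  proof -
    have "(f x + g x) powr p = ((a + b) * (a / (a + b) * (f x / a) + b / (a + b) * (g x / b))) powr p"
    proof -
      have "a + b \<noteq> 0" using pos by simp
      then show ?thesis using pos by (simp add: distrib_left)
    qed
    also have "\<dots> = (a + b) powr p * (a / (a + b) * (f x / a) + b / (a + b) * (g x / b)) powr p"
      by (rule powr_mult)
    also have "\<dots> \<le> (a + b) powr p * (a / (a + b) * (f x / a) powr p + b / (a + b) * (g x / b) powr p)"
      using pos nonneg \<open>p \<ge> 1\<close> by (intro mult_left_mono powr_convex_combination)
        (auto simp: add_divide_distrib[symmetric])
    also have "\<dots> = u * f x powr p + v * g x powr p"
      using pos nonneg by (simp add: u_def v_def powr_divide field_simps)
    finally show ?thesis .
  qed
  have "(\<integral>\<^sup>+x. ennreal ((f x + g x) powr p) \<partial>M)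
      \<le> (\<integral>\<^sup>+x. ennreal u * ennreal (f x powr p) + ennreal v * ennreal (g x powr p) \<partial>M)"
    using le uv by (intro nn_integral_mono)
      (simp flip: ennreal_mult ennreal_plus)
  also have "\<dots> = ennreal u * (\<integral>\<^sup>+x. ennreal (f x powr p) \<partial>M) + ennreal v * (\<integral>\<^sup>+x. ennreal (g x powr p) \<partial>M)"
    by (simp add: nn_integral_add nn_integral_cmult)
  also have "\<dots> \<le> ennreal u * ennreal (a powr p) + ennreal v * ennreal (b powr p)"
    by (intro add_mono mult_left_mono f g) auto
  also have "\<dots> = ennreal (u * a powr p + v * b powr p)"
    using uv by (simp flip: ennreal_mult ennreal_plus)
  also have "u * a powr p + v * b powr p = (a + b) powr p"
    using pos by (simp add: u_def v_def flip: distrib_left add_divide_distrib)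
  finally show ?thesis .
qed

text \<open>The root is real-valued so that triangle inequalities become real arithmetic. At
  infinity it takes the default value 0 of \<open>enn2real\<close>, hence the finiteness hypotheses
  in several lemmas below.\<close>

definition ennroot :: "real \<Rightarrow> ennreal \<Rightarrow> real" where
  "ennroot p x = enn2real x powr (1 / p)"

lemma ennroot_nonneg [simp]: "ennroot p x \<ge> 0"
  by (simp add: ennroot_def)

lemma ennroot_powr: "p \<ge> 1 \<Longrightarrow> x < \<infinity> \<Longrightarrow> ennreal (ennroot p x powr p) = x"
  by (cases x) (auto simp: ennroot_def powr_powr)

lemma ennroot_le:
  assumes "p \<ge> 1" "a \<ge> 0" "x \<le> ennreal (a powr p)"
  shows "ennroot p x \<le> a"
proof -
  have "enn2real x \<le> a powr p"
    using assms by (simp add: enn2real_leI)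
  then have "enn2real x powr (1 / p) \<le> (a powr p) powr (1 / p)"
    using assms by (intro powr_mono2) auto
  then show ?thesis using assms by (simp add: ennroot_def powr_powr)
qed

lemma le_ennreal_powr:
  assumes "p \<ge> 1" "x < \<infinity>" "ennroot p x \<le> a"
  shows "x \<le> ennreal (a powr p)"
proof -
  have "ennroot p x powr p \<le> a powr p"
    using assms by (intro powr_mono2) auto
  then show ?thesis by (metis assms(1,2) ennroot_powr ennreal_leI)
qed

lemma less_ennreal_powr:
  assumes "p \<ge> 1" "x < \<infinity>" "ennroot p x < a"
  shows "x < ennreal (a powr p)"
proof -
  have "ennroot p x powr p < a powr p"
    using assms by (intro powr_less_mono2) auto
  then show ?thesis by (metis assms(1,2) ennroot_powr ennreal_lessI powr_ge_zero le_less_trans)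
qed

lemma ennroot_eq_0_iff: "p \<ge> 1 \<Longrightarrow> x < \<infinity> \<Longrightarrow> ennroot p x = 0 \<longleftrightarrow> x = 0"
  by (cases x) (auto simp: ennroot_def)

subsection \<open>Gluing and the Wasserstein distance on the line\<close>

text \<open>Each label of mass zero occurs only on a null set, and there are only countably many
  labels.\<close>

lemma (in prob_space) AE_label_measure_neq_0:
  fixes l :: "'a \<Rightarrow> 'l::countable"
  assumes [measurable]: "l \<in> measurable M (count_space UNIV)"
  shows "AE x in M. measure M {y\<in>space M. l y = l x} \<noteq> 0"
proof -
  have "AE x in M. l x \<noteq> k" if "measure M {y\<in>space M. l y = k} = 0" for k
    using that by (subst AE_iff_measurable[OF _ refl]) (simp_all add: emeasure_eq_measure)
  then have "AE x in M. \<forall>k\<in>{k. measure M {y\<in>space M. l y = k} = 0}. l x \<noteq> k"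
    by (subst AE_ball_countable) auto
  then show ?thesis by eventually_elim auto
qed

text \<open>The glued measure has density \<open>1[s u = t v] / Q(t = s u)\<close> with respect to the product;
  countability of the labels makes this work without any disintegration theorem.\<close>

lemma glue_along_countable_label:
  fixes s :: "'a \<Rightarrow> 'l::countable" and t :: "'b \<Rightarrow> 'l"
  assumes "prob_space P" "prob_space Q"
    and [measurable]: "s \<in> measurable P (count_space UNIV)" "t \<in> measurable Q (count_space UNIV)"
    and label: "\<And>k. measure P {x\<in>space P. s x = k} = measure Q {y\<in>space Q. t y = k}"
  obtains R where "sets R = sets (P \<Otimes>\<^sub>M Q)" "distr R P fst = P" "distr R Q snd = Q"
    "AE w in R. s (fst w) = t (snd w)"
proof -
  interpret P: prob_space P by fact
  interpret Q: prob_space Q by fact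
  interpret PQ: pair_sigma_finite P Q ..
  define n where "n k = measure Q {y\<in>space Q. t y = k}" for k
  have nP: "measure P {x\<in>space P. s x = k} = n k" for k
    by (simp add: n_def label)
  have nonneg: "n k \<ge> 0" for k by (simp add: n_def)
  \<comment> \<open>If \<open>n (t v) = 0\<close>, the quotient is 0 by convention; almost no point
    carries such a label, so the marginals are not affected.\<close>
  define h where "h = (\<lambda>w. if s (fst w) = t (snd w) then ennreal (1 / n (t (snd w))) else 0)"
  have [measurable]: "h \<in> borel_measurable (P \<Otimes>\<^sub>M Q)"
    unfolding h_def by measurable
  define R where "R = density (P \<Otimes>\<^sub>M Q) h"
  have [measurable_cong]: "sets R = sets (P \<Otimes>\<^sub>M Q)" by (simp add: R_def)
  \<comment> \<open>Integrating out \<open>v\<close> leaves \<open>1 / n (s u)\<close> times the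
    mass \<open>n (s u)\<close> of the matching cell; this yields the first marginal.\<close>
  have AE_P: "AE u in P. (\<integral>\<^sup>+v. h (u, v) \<partial>Q) = 1"
  proof -
    have "AE u in P. n (s u) \<noteq> 0"
      using P.AE_label_measure_neq_0[of s] by (simp add: nP)
    then show ?thesis
    proof eventually_elim
      fix u assume u: "n (s u) \<noteq> 0"
      have "(\<integral>\<^sup>+v. h (u, v) \<partial>Q) = (\<integral>\<^sup>+v. ennreal (1 / n (s u)) * indicator {y\<in>space Q. t y = s u} v \<partial>Q)"
        by (intro nn_integral_cong) (auto simp: h_def)
      also have "\<dots> = ennreal (1 / n (s u)) * ennreal (n (s u))"
        by (subst nn_integral_cmult_indicator) (auto simp: n_def Q.emeasure_eq_measure)
      finally show "(\<integral>\<^sup>+v. h (u, v) \<partial>Q) = 1"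
        using u nonneg by (simp flip: ennreal_mult)
    qed
  qed
  \<comment> \<open>The cell of \<open>P\<close> with label \<open>t v\<close> also has mass
    \<open>n (t v)\<close>, so the same density is normalised in the other variable.\<close>
  have AE_Q: "AE v in Q. (\<integral>\<^sup>+u. h (u, v) \<partial>P) = 1"
  proof -
    have "AE v in Q. n (t v) \<noteq> 0"
      using Q.AE_label_measure_neq_0[of t] by (simp add: n_def[symmetric])
    then show ?thesis
    proof eventually_elim
      fix v assume v: "n (t v) \<noteq> 0"
      have "(\<integral>\<^sup>+u. h (u, v) \<partial>P) = (\<integral>\<^sup>+u. ennreal (1 / n (t v)) * indicator {x\<in>space P. s x = t v} u \<partial>P)"
        by (intro nn_integral_cong) (auto simp: h_def)
      also have "\<dots> = ennreal (1 / n (t v)) * ennreal (n (t v))"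
        by (subst nn_integral_cmult_indicator) (auto simp: nP P.emeasure_eq_measure)
      finally show "(\<integral>\<^sup>+u. h (u, v) \<partial>P) = 1"
        using v nonneg by (simp flip: ennreal_mult)
    qed
  qed
  show thesis
  proof
    show "sets R = sets (P \<Otimes>\<^sub>M Q)" by fact
    show "distr R P fst = P"
    proof (rule measure_eqI)
      fix A assume "A \<in> sets (distr R P fst)"
      then have [measurable]: "A \<in> sets P" by simp
      have "emeasure (distr R P fst) A = emeasure R (fst -` A \<inter> space R)"
        by (rule emeasure_distr) auto
      also have "\<dots> = (\<integral>\<^sup>+w. h w * indicator (fst -` A \<inter> space (P \<Otimes>\<^sub>M Q)) w \<partial>(P \<Otimes>\<^sub>M Q))"
        by (simp add: R_def emeasure_density)
      also have "\<dots> = (\<integral>\<^sup>+w. h w * indicator A (fst w) \<partial>(P \<Otimes>\<^sub>M Q))"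
        by (intro nn_integral_cong) (auto split: split_indicator)
      also have "\<dots> = (\<integral>\<^sup>+u. (\<integral>\<^sup>+v. h (u, v) * indicator A u \<partial>Q) \<partial>P)"
        by (subst Q.nn_integral_fst[symmetric]) auto
      also have "\<dots> = (\<integral>\<^sup>+u. (\<integral>\<^sup>+v. h (u, v) \<partial>Q) * indicator A u \<partial>P)"
        by (intro nn_integral_cong nn_integral_multc) auto
      also have "\<dots> = (\<integral>\<^sup>+u. indicator A u \<partial>P)"
        using AE_P by (intro nn_integral_cong_AE) auto
      finally show "emeasure (distr R P fst) A = emeasure P A" by simp
    qed simp
    show "distr R Q snd = Q"
    proof (rule measure_eqI)
      fix A assume "A \<in> sets (distr R Q snd)"
      then have [measurable]: "A \<in> sets Q" by simp
      have "emeasure (distr R Q snd) A = emeasure R (snd -` A \<inter> space R)"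
        by (rule emeasure_distr) auto
      also have "\<dots> = (\<integral>\<^sup>+w. h w * indicator (snd -` A \<inter> space (P \<Otimes>\<^sub>M Q)) w \<partial>(P \<Otimes>\<^sub>M Q))"
        by (simp add: R_def emeasure_density)
      also have "\<dots> = (\<integral>\<^sup>+w. h w * indicator A (snd w) \<partial>(P \<Otimes>\<^sub>M Q))"
        by (intro nn_integral_cong) (auto split: split_indicator)
      also have "\<dots> = (\<integral>\<^sup>+v. (\<integral>\<^sup>+u. h (u, v) * indicator A v \<partial>P) \<partial>Q)"
        by (subst PQ.nn_integral_snd[symmetric]) auto
      also have "\<dots> = (\<integral>\<^sup>+v. (\<integral>\<^sup>+u. h (u, v) \<partial>P) * indicator A v \<partial>Q)"
        by (intro nn_integral_cong nn_integral_multc) auto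
      also have "\<dots> = (\<integral>\<^sup>+v. indicator A v \<partial>Q)"
        using AE_Q by (intro nn_integral_cong_AE) auto
      finally show "emeasure (distr R Q snd) A = emeasure Q A" by simp
    qed simp
    show "AE w in R. s (fst w) = t (snd w)"
      unfolding R_def by (subst AE_density) (auto simp: h_def)
  qed
qed

text \<open>The joint law of \<open>X\<close> and \<open>Y\<close> is a coupling of their laws.
  Upper bounds on \<open>Wpp\<close> from explicit couplings all go through this.\<close>

lemma Wpp_distr_le:
  assumes "prob_space M" and [measurable]: "X \<in> borel_measurable M" "Y \<in> borel_measurable M"
  shows "Wpp p (distr M borel X) (distr M borel Y) \<le> (\<integral>\<^sup>+x. ennreal (\<bar>X x - Y x\<bar> powr p) \<partial>M)"
proof -
  interpret prob_space M by fact
  let ?\<pi> = "distr M (borel \<Otimes>\<^sub>M borel) (\<lambda>x. (X x, Y x))"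
  have "?\<pi> \<in> couplings (distr M borel X) (distr M borel Y)"
    by (auto simp: couplings_def distr_distr comp_def intro!: prob_space_distr)
  then have "Wpp p (distr M borel X) (distr M borel Y) \<le> (\<integral>\<^sup>+z. ennreal (\<bar>fst z - snd z\<bar> powr p) \<partial>?\<pi>)"
    unfolding Wpp_def by (rule INF_lower)
  then show ?thesis by (simp add: nn_integral_distr)
qed

text \<open>Exchanging the coordinates of a coupling preserves its cost.\<close>

lemma Wpp_commute: "Wpp p \<mu> \<nu> = Wpp p \<nu> \<mu>"
proof -
  have "Wpp p \<nu> \<mu> \<le> (\<integral>\<^sup>+z. ennreal (\<bar>fst z - snd z\<bar> powr p) \<partial>\<pi>)" if "\<pi> \<in> couplings \<mu> \<nu>" for \<mu> \<nu> \<pi>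
  proof -
    have [measurable_cong]: "sets \<pi> = sets (borel \<Otimes>\<^sub>M borel)" and "prob_space \<pi>"
      and m: "distr \<pi> borel fst = \<mu>" "distr \<pi> borel snd = \<nu>"
      using that by (auto simp: couplings_def)
    have "Wpp p (distr \<pi> borel snd) (distr \<pi> borel fst) \<le> (\<integral>\<^sup>+z. ennreal (\<bar>snd z - fst z\<bar> powr p) \<partial>\<pi>)"
      by (rule Wpp_distr_le) (use \<open>prob_space \<pi>\<close> in auto)
    then show ?thesis by (simp add: m abs_minus_commute)
  qed
  then have "Wpp p \<nu> \<mu> \<le> Wpp p \<mu> \<nu>" for \<mu> \<nu>
    unfolding Wpp_def[of p \<mu> \<nu>] by (intro INF_greatest)
  then show ?thesis by (intro antisym)
qed

lemma Wpp_self: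
  assumes "prob_space \<mu>" and [measurable_cong]: "sets \<mu> = sets borel"
  shows "Wpp p \<mu> \<mu> = 0"
  using Wpp_distr_le[of \<mu> "\<lambda>x. x" "\<lambda>x. x" p] assms by (simp add: distr_id2)

text \<open>The strict bounds provide couplings of cost below \<open>a powr p\<close> and
  \<open>b powr p\<close>. Gluing them along the cell of the shared coordinate lets its two copies
  differ by at most \<open>e\<close>, and Minkowski's inequality adds up the three
  displacements.\<close>

lemma Wpp_triangle_less:
  assumes "p \<ge> 1" and pos: "a > 0" "b > 0" "e > 0"
    and a: "Wpp p \<mu> \<eta> < ennreal (a powr p)" and b: "Wpp p \<eta> \<nu> < ennreal (b powr p)"
  shows "Wpp p \<mu> \<nu> \<le> ennreal ((a + b + e) powr p)"
proof -
  obtain P where P: "P \<in> couplings \<mu> \<eta>" "(\<integral>\<^sup>+z. ennreal (\<bar>fst z - snd z\<bar> powr p) \<partial>P) < ennreal (a powr p)"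
    using a by (auto simp: Wpp_def INF_less_iff)
  obtain Q where Q: "Q \<in> couplings \<eta> \<nu>" "(\<integral>\<^sup>+z. ennreal (\<bar>fst z - snd z\<bar> powr p) \<partial>Q) < ennreal (b powr p)"
    using b by (auto simp: Wpp_def INF_less_iff)
  have [measurable_cong]: "sets P = sets (borel \<Otimes>\<^sub>M borel)" "sets Q = sets (borel \<Otimes>\<^sub>M borel)"
    and PQ: "prob_space P" "prob_space Q"
    and P_distr: "distr P borel fst = \<mu>" "distr P borel snd = \<eta>"
    and Q_distr: "distr Q borel fst = \<eta>" "distr Q borel snd = \<nu>"
    using P(1) Q(1) by (auto simp: couplings_def)
  \<comment> \<open>\<open>l y\<close> is the index of the cell of width \<open>e\<close> containing
    \<open>y\<close>; integer labels are countable, as the gluing requires.\<close>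
  define l :: "real \<Rightarrow> int" where "l y = \<lfloor>y / e\<rfloor>" for y
  have [measurable]: "l \<in> measurable borel (count_space UNIV)"
    unfolding l_def by measurable
  have close: "\<bar>y - y'\<bar> \<le> e" if "l y = l y'" for y y'
  proof -
    have "\<bar>y / e - y' / e\<bar> \<le> 1" using that unfolding l_def by linarith
    then show ?thesis using \<open>e > 0\<close> by (simp add: divide_simps abs_if split: if_splits)
  qed
  have cell: "measure (distr N borel g) {y. l y = k} = measure N {x\<in>space N. l (g x) = k}"
    if [measurable]: "g \<in> borel_measurable N" for N :: "(real \<times> real) measure" and g k
    by (subst measure_distr) (auto intro!: arg_cong[of _ _ "measure N"])
  \<comment> \<open>Both sides are the mass that \<open>\<eta>\<close> gives to cell
    \<open>k\<close>.\<close>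
  have label: "measure P {x\<in>space P. l (snd x) = k} = measure Q {y\<in>space Q. l (fst y) = k}" for k
    using cell[of snd P k] cell[of fst Q k] by (simp add: P_distr Q_distr)
  obtain R where [measurable_cong]: "sets R = sets (P \<Otimes>\<^sub>M Q)"
    and R: "distr R P fst = P" "distr R Q snd = Q" "AE w in R. l (snd (fst w)) = l (fst (snd w))"
    by (rule glue_along_countable_label[OF PQ _ _ label]) auto
  have "prob_space (distr R P fst)" by (simp add: R PQ)
  then interpret R: prob_space R by (rule prob_space_distrD[rotated]) simp
  have marg: "distr R borel (\<lambda>w. fst (fst w)) = \<mu>" "distr R borel (\<lambda>w. snd (snd w)) = \<nu>"
    using distr_distr[of fst P borel fst R] distr_distr[of snd Q borel snd R]
    by (simp_all add: R P_distr Q_distr comp_def)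
  have fP: "(\<integral>\<^sup>+w. ennreal (\<bar>fst (fst w) - snd (fst w)\<bar> powr p) \<partial>R) \<le> ennreal (a powr p)"
    using P(2) nn_integral_distr[of fst R P "\<lambda>z. ennreal (\<bar>fst z - snd z\<bar> powr p)"]
    by (simp add: R)
  have fQ: "(\<integral>\<^sup>+w. ennreal (\<bar>fst (snd w) - snd (snd w)\<bar> powr p) \<partial>R) \<le> ennreal (b powr p)"
    using Q(2) nn_integral_distr[of snd R Q "\<lambda>z. ennreal (\<bar>fst z - snd z\<bar> powr p)"]
    by (simp add: R)
  have "Wpp p \<mu> \<nu> \<le> (\<integral>\<^sup>+w. ennreal (\<bar>fst (fst w) - snd (snd w)\<bar> powr p) \<partial>R)"
    unfolding marg[symmetric] by (rule Wpp_distr_le) (auto intro: R.prob_space_axioms)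
  also have "\<dots> \<le> (\<integral>\<^sup>+w. ennreal ((\<bar>fst (fst w) - snd (fst w)\<bar> + \<bar>fst (snd w) - snd (snd w)\<bar> + e) powr p) \<partial>R)"
    using R(3)
  proof (intro nn_integral_mono_AE, eventually_elim)
    case (elim w)
    from close[OF elim(2)] show ?case
      using \<open>p \<ge> 1\<close> by (intro ennreal_leI powr_mono2) auto
  qed
  \<comment> \<open>Minkowski's inequality is used twice; the constant function \<open>e\<close>
    contributes exactly \<open>e powr p\<close>, as \<open>R\<close> has total mass 1.\<close>
  also have "\<dots> \<le> ennreal ((a + b + e) powr p)"
    using pos \<open>p \<ge> 1\<close> fP fQ
    by (intro nn_integral_Minkowski) (auto simp: R.emeasure_space_1)
  finally show ?thesis .
qed

text \<open>A slack \<open>d\<close> is added to both roots and also taken as the cell width. The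
  choice \<open>d = 1\<close> gives finiteness, and letting \<open>d\<close> tend to 0 gives the
  inequality.\<close>

lemma Wpp_triangle:
  assumes "p \<ge> 1" "Wpp p \<mu> \<eta> < \<infinity>" "Wpp p \<eta> \<nu> < \<infinity>"
  shows "Wpp p \<mu> \<nu> < \<infinity>"
    and "ennroot p (Wpp p \<mu> \<nu>) \<le> ennroot p (Wpp p \<mu> \<eta>) + ennroot p (Wpp p \<eta> \<nu>)"
proof -
  have le: "Wpp p \<mu> \<nu> \<le> ennreal ((ennroot p (Wpp p \<mu> \<eta>) + d + (ennroot p (Wpp p \<eta> \<nu>) + d) + d) powr p)"
    if "d > 0" for d
    using that assms by (intro Wpp_triangle_less[where \<eta> = \<eta>] less_ennreal_powr) (auto intro: add_nonneg_pos)
  show "Wpp p \<mu> \<nu> < \<infinity>"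
    using le[of 1] by (auto intro: le_less_trans)
  show "ennroot p (Wpp p \<mu> \<nu>) \<le> ennroot p (Wpp p \<mu> \<eta>) + ennroot p (Wpp p \<eta> \<nu>)"
  proof (rule field_le_epsilon)
    fix d :: real assume "d > 0"
    with le[of "d / 3"] \<open>p \<ge> 1\<close> have "ennroot p (Wpp p \<mu> \<nu>) \<le>
        ennroot p (Wpp p \<mu> \<eta>) + d / 3 + (ennroot p (Wpp p \<eta> \<nu>) + d / 3) + d / 3"
      by (intro ennroot_le) auto
    then show "ennroot p (Wpp p \<mu> \<nu>) \<le> ennroot p (Wpp p \<mu> \<eta>) + ennroot p (Wpp p \<eta> \<nu>) + d" by simp
  qed
qed

section \<open>Definiteness on the line by characteristic functions\<close>

lemma norm_iexp_diff_le: "norm (iexp a - iexp b) \<le> \<bar>a - b\<bar>" for a b :: real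
proof -
  have "iexp a - iexp b = iexp b * (iexp (a - b) - 1)"
    by (simp add: algebra_simps flip: exp_add)
  then have "norm (iexp a - iexp b) = norm (iexp (a - b) - 1)"
    by (simp add: norm_mult)
  also have "\<dots> \<le> \<bar>a - b\<bar>" using iexp_approx1[of "a - b" 0] by simp
  finally show ?thesis .
qed

text \<open>Cost zero yields couplings of arbitrarily small cost. Since \<open>iexp\<close> is
  1-Lipschitz, the characteristic functions then differ by arbitrarily little at each
  \<open>t\<close>, and Levy's uniqueness theorem applies.\<close>

lemma Wpp_eq_0_imp_eq:
  assumes "p \<ge> 1" and \<mu>: "prob_space \<mu>" "sets \<mu> = sets borel" and \<nu>: "prob_space \<nu>" "sets \<nu> = sets borel"
    and zero: "Wpp p \<mu> \<nu> = 0"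
  shows "\<mu> = \<nu>"
proof (rule Levy_uniqueness)
  show "real_distribution \<mu>" "real_distribution \<nu>"
    using \<mu> \<nu> by (auto simp: real_distribution_def real_distribution_axioms_def sets_eq_imp_space_eq)
  show "char \<mu> = char \<nu>"
  proof
    fix t
    have le: "norm (char \<mu> t - char \<nu> t) \<le> 2 * \<bar>t\<bar> * d" if "d > 0" for d
    proof -
      have "Wpp p \<mu> \<nu> < ennreal (d powr p)" using zero that by simp
      then obtain P where P: "P \<in> couplings \<mu> \<nu>" "(\<integral>\<^sup>+z. ennreal (\<bar>fst z - snd z\<bar> powr p) \<partial>P) < ennreal (d powr p)"
        by (auto simp: Wpp_def INF_less_iff)
      have [measurable_cong]: "sets P = sets (borel \<Otimes>\<^sub>M borel)" and "prob_space P"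
        and P_distr: "distr P borel fst = \<mu>" "distr P borel snd = \<nu>"
        using P(1) by (auto simp: couplings_def)
      interpret P: prob_space P by fact
      have int: "integrable P (\<lambda>z. \<bar>fst z - snd z\<bar> powr p)"
        using P(2) by (intro integrableI_nonneg) (auto intro: order.strict_trans)
      have cost: "(\<integral>z. \<bar>fst z - snd z\<bar> powr p \<partial>P) \<le> d powr p"
        using P(2) nn_integral_eq_integral[OF int] by (simp add: ennreal_less_iff less_imp_le)
      \<comment> \<open>A pointwise substitute for Hoelder's inequality: beyond \<open>d\<close>,
        write \<open>z = z powr (1 - p) * z powr p\<close> and use that \<open>1 - p\<close> is
        nonpositive. Integrated against a cost of at most \<open>d powr p\<close>, it bounds the
        mean displacement by \<open>2 * d\<close>.\<close>
      have pw: "z \<le> d + d powr (1 - p) * z powr p" if "z \<ge> 0" for z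
      proof (cases "z \<le> d")
        case False
        with \<open>d > 0\<close> have "z = z powr (1 - p) * z powr p" by (simp flip: powr_add)
        also have "\<dots> \<le> d powr (1 - p) * z powr p"
          using False \<open>d > 0\<close> \<open>p \<ge> 1\<close> by (intro mult_right_mono powr_mono2') auto
        finally show ?thesis using \<open>d > 0\<close> by simp
      qed (simp add: add_increasing2)
      have "char \<mu> t - char \<nu> t = (\<integral>z. iexp (t * fst z) \<partial>P) - (\<integral>z. iexp (t * snd z) \<partial>P)"
        unfolding P_distr[symmetric] char_def by (simp add: integral_distr)
      also have "\<dots> = (\<integral>z. iexp (t * fst z) - iexp (t * snd z) \<partial>P)"
        by (rule Bochner_Integration.integral_diff[symmetric]; rule P.integrable_iexp; measurable)
      also have "norm \<dots> \<le> (\<integral>z. \<bar>t\<bar> * (d + d powr (1 - p) * \<bar>fst z - snd z\<bar> powr p) \<partial>P)"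
      proof (rule order_trans[OF integral_norm_bound integral_mono])
        show "integrable P (\<lambda>z. norm (iexp (t * fst z) - iexp (t * snd z)))"
          by (rule integrable_norm, rule Bochner_Integration.integrable_diff; rule P.integrable_iexp; measurable)
        show "integrable P (\<lambda>z. \<bar>t\<bar> * (d + d powr (1 - p) * \<bar>fst z - snd z\<bar> powr p))"
          using int by simp
        fix z
        have "norm (iexp (t * fst z) - iexp (t * snd z)) \<le> \<bar>t\<bar> * \<bar>fst z - snd z\<bar>"
          using norm_iexp_diff_le[of "t * fst z" "t * snd z"] by (simp flip: abs_mult right_diff_distrib)
        also have "\<dots> \<le> \<bar>t\<bar> * (d + d powr (1 - p) * \<bar>fst z - snd z\<bar> powr p)"
          by (intro mult_left_mono pw) auto
        finally show "norm (iexp (t * fst z) - iexp (t * snd z)) \<le> \<bar>t\<bar> * (d + d powr (1 - p) * \<bar>fst z - snd z\<bar> powr p)" .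
      qed
      also have "\<dots> = \<bar>t\<bar> * (d + d powr (1 - p) * (\<integral>z. \<bar>fst z - snd z\<bar> powr p \<partial>P))"
        using int by (simp add: P.prob_space)
      also have "\<dots> \<le> \<bar>t\<bar> * (d + d powr (1 - p) * d powr p)"
        by (intro mult_left_mono add_left_mono cost) auto
      also have "\<dots> = 2 * \<bar>t\<bar> * d" using \<open>d > 0\<close> by (simp flip: powr_add)
      finally show ?thesis .
    qed
    have "norm (char \<mu> t - char \<nu> t) \<le> 0 + e" if "e > 0" for e
    proof -
      \<comment> \<open>The summand 1 in the denominator covers \<open>t = 0\<close>.\<close>
      have "norm (char \<mu> t - char \<nu> t) \<le> 2 * \<bar>t\<bar> * (e / (2 * \<bar>t\<bar> + 1))"
        using that by (intro le divide_pos_pos) auto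
      also have "\<dots> = e * (2 * \<bar>t\<bar> / (2 * \<bar>t\<bar> + 1))" by simp
      also have "\<dots> \<le> e * 1"
        using that by (intro mult_left_mono) (auto simp: divide_le_eq_1 add_nonneg_pos)
      finally show ?thesis by simp
    qed
    then have "norm (char \<mu> t - char \<nu> t) \<le> 0" by (rule field_le_epsilon)
    then show "char \<mu> t = char \<nu> t" by simp
  qed
qed

subsection \<open>The theorem of Cramer and Wold\<close>

text \<open>Normalise the weight \<open>f\<close> to a probability density and push it forward along
  \<open>X\<close>. Up to the factor \<open>Z\<close>, the cosine integrals give the real and
  imaginary parts of the characteristic function of the image, so Levy's uniqueness theorem
  identifies the two images. A weight of total mass zero vanishes almost everywhere.\<close>

lemma weighted_distr_unique:
  fixes X :: "'a \<Rightarrow> real" and f :: "'a \<Rightarrow> real"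
  assumes "prob_space M" "prob_space N" and sets_eq[measurable_cong]: "sets N = sets M"
    and [measurable]: "X \<in> borel_measurable M" "f \<in> borel_measurable M" "A \<in> sets borel"
    and f: "\<And>x. 0 \<le> f x" "\<And>x. f x \<le> K"
    and eq: "\<And>t c. (\<integral>x. f x * cos (t * X x + c) \<partial>M) = (\<integral>x. f x * cos (t * X x + c) \<partial>N)"
  shows "(\<integral>x. f x * indicator A (X x) \<partial>M) = (\<integral>x. f x * indicator A (X x) \<partial>N)"
proof -
  define Z where "Z = (\<integral>x. f x \<partial>M)"
  \<comment> \<open>At \<open>t = c = 0\<close> the cosine is 1, so the total weights agree.\<close>
  have Z: "Z = (\<integral>x. f x \<partial>N)" using eq[of 0 0] by (simp add: Z_def)
  have int: "integrable L (\<lambda>x. f x * g x)"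
    if "prob_space L" and [measurable_cong]: "sets L = sets M" and [measurable]: "g \<in> borel_measurable M" 
      and "\<And>x. \<bar>g x\<bar> \<le> 1" for L and g :: "'a \<Rightarrow> real"
  proof -
    interpret L: prob_space L by fact
    have "\<bar>f x * g x\<bar> \<le> K" for x
      using f[of x] that(4)[of x] mult_mono[of "f x" K "\<bar>g x\<bar>" 1] by (auto simp: abs_mult)
    then show ?thesis by (intro L.integrable_const_bound[of _ K]) auto
  qed
  show ?thesis
  proof (cases "Z = 0")
    case True
    have zero: "(\<integral>x. f x * indicator A (X x) \<partial>L) = 0"
      if "prob_space L" and [measurable_cong]: "sets L = sets M" and "(\<integral>x. f x \<partial>L) = 0" for L
    proof -
      have "AE x in L. f x = 0"
        using int[OF that(1,2), of "\<lambda>_. 1"] that f by (subst (asm) integral_nonneg_eq_0_iff_AE) auto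
      then have "AE x in L. f x * indicator A (X x) = 0" by eventually_elim auto
      then show ?thesis by (simp add: integral_eq_zero_AE)
    qed
    show ?thesis using zero[of M] zero[of N] assms(1,2) sets_eq Z True by (simp add: Z_def)
  next
    case False
    have "Z \<ge> 0" unfolding Z_def using f by (intro integral_nonneg_AE) auto
    with False have "Z > 0" by simp
    define D where "D L = distr (density L (\<lambda>x. ennreal (f x / Z))) borel X" for L
    \<comment> \<open>The phase \<open>- pi / 2\<close> turns the cosine into a sine and so yields
      the imaginary part.\<close>
    have D: "real_distribution (D L)"
         "char (D L) t = Complex ((\<integral>x. f x * cos (t * X x + 0) \<partial>L) / Z) ((\<integral>x. f x * cos (t * X x + (- pi / 2)) \<partial>L) / Z)"
         "measure (D L) A = (\<integral>x. f x * indicator A (X x) \<partial>L) / Z"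
      if L: "prob_space L" and sL[measurable_cong]: "sets L = sets M" and ZL: "(\<integral>x. f x \<partial>L) = Z" for L t
    proof -
      have "emeasure (density L (\<lambda>x. ennreal (f x / Z))) (space L) = (\<integral>\<^sup>+x. ennreal (f x / Z) \<partial>L)"
        by (subst emeasure_density) (auto intro!: nn_integral_cong)
      also have "\<dots> = ennreal (\<integral>x. f x / Z \<partial>L)"
        using int[OF L sL, of "\<lambda>_. 1"] f \<open>Z > 0\<close> by (intro nn_integral_eq_integral) auto
      also have "\<dots> = 1" using ZL \<open>Z > 0\<close> by simp
      finally interpret DL: prob_space "density L (\<lambda>x. ennreal (f x / Z))"
        by (intro prob_spaceI) simp
      show "real_distribution (D L)"
        unfolding D_def by (intro DL.real_distribution_distr) auto
      have integral_D: "(\<integral>x. g x \<partial>D L) = (\<integral>x. f x * g (X x) \<partial>L) / Z"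
        if [measurable]: "g \<in> borel_measurable borel" for g :: "real \<Rightarrow> real"
        using f \<open>Z > 0\<close> by (simp add: D_def integral_distr integral_density)
      interpret D: real_distribution "D L" by fact
      have intD: "integrable (D L) (\<lambda>x. cos (t * x))" "integrable (D L) (\<lambda>x. sin (t * x))"
        by (auto intro!: D.integrable_const_bound[of _ 1])
      have "Re (char (D L) t) = (\<integral>x. cos (t * x) \<partial>D L)" "Im (char (D L) t) = (\<integral>x. sin (t * x) \<partial>D L)"
        unfolding char_def
        by (simp_all add: integral_Re[symmetric] integral_Im[symmetric] D.integrable_iexp Re_exp Im_exp)
      then show "char (D L) t = Complex ((\<integral>x. f x * cos (t * X x + 0) \<partial>L) / Z) ((\<integral>x. f x * cos (t * X x + (- pi / 2)) \<partial>L) / Z)"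
        by (simp add: complex_eq_iff integral_D cos_diff)
      show "measure (D L) A = (\<integral>x. f x * indicator A (X x) \<partial>L) / Z"
        using integral_D[of "indicator A"] by simp
    qed
    have "D M = D N"
    proof (rule Levy_uniqueness)
      show "char (D M) = char (D N)"
        unfolding fun_eq_iff D(2)[OF assms(1) refl Z_def[symmetric]] D(2)[OF assms(2) sets_eq Z[symmetric]] eq
        by simp
    qed (use D(1) assms(1,2) sets_eq Z Z_def in auto)
    then show ?thesis
      using D(3)[of M] D(3)[of N] assms(1,2) sets_eq Z \<open>Z > 0\<close> by (simp add: Z_def[symmetric])
  qed
qed

text \<open>The coordinates are treated one at a time by the one-dimensional uniqueness theorem; \<open>1 + cos\<close>
  serves as a weight because the weights must be nonnegative.\<close>

lemma cos_integrals_determine_boxes: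
  fixes \<mu> \<nu> :: "'a::euclidean_space measure"
  assumes "prob_space \<mu>" "prob_space \<nu>" and sets_eq[measurable_cong]: "sets \<mu> = sets borel" "sets \<nu> = sets borel"
    and eq: "\<And>s c. (\<integral>x. cos (x \<bullet> s + c) \<partial>\<mu>) = (\<integral>x. cos (x \<bullet> s + c) \<partial>\<nu>)"
    and "finite B" and A: "\<And>b. A b \<in> sets borel"
  shows "(\<integral>x. (\<Prod>b\<in>B. indicator (A b) (x \<bullet> b)) * cos (x \<bullet> s + c) \<partial>\<mu>)
       = (\<integral>x. (\<Prod>b\<in>B. indicator (A b) (x \<bullet> b)) * cos (x \<bullet> s + c) \<partial>\<nu>)"
  using \<open>finite B\<close>
proof (induction B arbitrary: s c rule: finite_induct)
  case empty
  show ?case using eq by simp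
next
  case (insert b B)
  note [measurable] = A
  define w :: "'a \<Rightarrow> real" where "w x = (\<Prod>b\<in>B. indicator (A b) (x \<bullet> b))" for x
  have [measurable]: "w \<in> borel_measurable borel" unfolding w_def by measurable
  have w: "0 \<le> w x" "w x \<le> 1" for x
    unfolding w_def by (auto intro!: prod_nonneg prod_le_1)
  have IH: "(\<integral>x. w x * cos (x \<bullet> s + c) \<partial>\<mu>) = (\<integral>x. w x * cos (x \<bullet> s + c) \<partial>\<nu>)" for s c
    using insert.IH by (simp add: w_def)
  have int: "integrable L (\<lambda>x. w x * g x)"
    if "prob_space L" and [measurable_cong]: "sets L = sets borel" and [measurable]: "g \<in> borel_measurable borel"
      and "\<And>x. \<bar>g x\<bar> \<le> 1" for L and g :: "'a \<Rightarrow> real"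
  proof -
    interpret L: prob_space L by fact
    have "\<bar>w x * g x\<bar> \<le> 1" for x
      using w[of x] that(4)[of x] mult_mono[of "w x" 1 "\<bar>g x\<bar>" 1] by (auto simp: abs_mult)
    then show ?thesis by (intro L.integrable_const_bound[of _ 1]) auto
  qed
  \<comment> \<open>The product formula for cosines turns the extra factor into shifts of frequency
    and phase. Every resulting term has the shape covered by \<open>IH\<close>, which is why the
    induction keeps \<open>s\<close> and \<open>c\<close> arbitrary.\<close>
  have expand: "(\<integral>x. (w x * (1 + k * cos (x \<bullet> s + c))) * cos (t * (x \<bullet> b) + e) \<partial>L) =
      (\<integral>x. w x * cos (x \<bullet> (t *\<^sub>R b) + e) \<partial>L) + k / 2 * (\<integral>x. w x * cos (x \<bullet> (s - t *\<^sub>R b) + (c - e)) \<partial>L)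
      + k / 2 * (\<integral>x. w x * cos (x \<bullet> (s + t *\<^sub>R b) + (c + e)) \<partial>L)"
    if "prob_space L" "sets L = sets borel" for L s c t e and k :: real
  proof -
    note i = int[OF that]
    have alg: "(u * (1 + k * C)) * E = u * E + k / 2 * (u * P) + k / 2 * (u * Q)"
      if "C * E = (P + Q) / 2" for u C E P Q :: real
    proof -
      have "(u * (1 + k * C)) * E = u * E + u * k * (C * E)" by (simp add: algebra_simps)
      then show ?thesis unfolding that by (simp add: field_simps)
    qed
    have "(w x * (1 + k * cos (x \<bullet> s + c))) * cos (t * (x \<bullet> b) + e) =
      w x * cos (x \<bullet> (t *\<^sub>R b) + e) + k / 2 * (w x * cos (x \<bullet> (s - t *\<^sub>R b) + (c - e)))
      + k / 2 * (w x * cos (x \<bullet> (s + t *\<^sub>R b) + (c + e)))" for x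
    proof -
      have "cos (x \<bullet> s + c) * cos (t * (x \<bullet> b) + e) =
          (cos ((x \<bullet> s + c) - (t * (x \<bullet> b) + e)) + cos ((x \<bullet> s + c) + (t * (x \<bullet> b) + e))) / 2"
        by (rule cos_times_cos)
      moreover have "(x \<bullet> s + c) - (t * (x \<bullet> b) + e) = x \<bullet> (s - t *\<^sub>R b) + (c - e)"
         "(x \<bullet> s + c) + (t * (x \<bullet> b) + e) = x \<bullet> (s + t *\<^sub>R b) + (c + e)"
        by (simp_all add: inner_diff_right inner_add_right)
      ultimately have "cos (x \<bullet> s + c) * cos (t * (x \<bullet> b) + e) =
          (cos (x \<bullet> (s - t *\<^sub>R b) + (c - e)) + cos (x \<bullet> (s + t *\<^sub>R b) + (c + e))) / 2" by simp
      from alg[OF this] show ?thesis by simp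
    qed
    then show ?thesis by (simp add: i)
  qed
  \<comment> \<open>For \<open>\<bar>k\<bar> \<le> 1\<close> the weight lies between 0 and 2, so the
    one-dimensional result applies to the coordinate along \<open>b\<close>.\<close>
  have step: "(\<integral>x. (w x * (1 + k * cos (x \<bullet> s + c))) * indicator (A b) (x \<bullet> b) \<partial>\<mu>) =
     (\<integral>x. (w x * (1 + k * cos (x \<bullet> s + c))) * indicator (A b) (x \<bullet> b) \<partial>\<nu>)" if "\<bar>k\<bar> \<le> 1" for k s c
  proof (rule weighted_distr_unique[where K = 2])
    fix x
    have "\<bar>k * cos (x \<bullet> s + c)\<bar> \<le> 1"
      using that mult_mono[of "\<bar>k\<bar>" 1 "\<bar>cos (x \<bullet> s + c)\<bar>" 1] by (auto simp: abs_mult)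
    then show "0 \<le> w x * (1 + k * cos (x \<bullet> s + c))" "w x * (1 + k * cos (x \<bullet> s + c)) \<le> 2"
      using w[of x] mult_mono[of "w x" 1 "1 + k * cos (x \<bullet> s + c)" 2] by auto
  next
    fix t e
    show "(\<integral>x. (w x * (1 + k * cos (x \<bullet> s + c))) * cos (t * (x \<bullet> b) + e) \<partial>\<mu>) =
       (\<integral>x. (w x * (1 + k * cos (x \<bullet> s + c))) * cos (t * (x \<bullet> b) + e) \<partial>\<nu>)"
      unfolding expand[OF assms(1,3)] expand[OF assms(2,4)] IH ..
  qed (use assms in \<open>auto simp: sets_eq\<close>)
  \<comment> \<open>The integral for \<open>k = 1\<close> minus the one for \<open>k = 0\<close>
    isolates the cosine term.\<close>
  have split: "(\<integral>x. (\<Prod>b\<in>insert b B. indicator (A b) (x \<bullet> b)) * cos (x \<bullet> s + c) \<partial>L) =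
      (\<integral>x. (w x * (1 + 1 * cos (x \<bullet> s + c))) * indicator (A b) (x \<bullet> b) \<partial>L) -
      (\<integral>x. (w x * (1 + 0 * cos (x \<bullet> s + c))) * indicator (A b) (x \<bullet> b) \<partial>L)"
    if "prob_space L" "sets L = sets borel" for L
  proof -
    have i: "integrable L (\<lambda>x. w x * indicator (A b) (x \<bullet> b))"
      "integrable L (\<lambda>x. w x * (cos (x \<bullet> s + c) * indicator (A b) (x \<bullet> b)))"
      by (auto intro!: int that split: split_indicator)
    have "(\<lambda>x. (w x * (1 + 1 * cos (x \<bullet> s + c))) * indicator (A b) (x \<bullet> b)) =
      (\<lambda>x. w x * indicator (A b) (x \<bullet> b) + w x * (cos (x \<bullet> s + c) * indicator (A b) (x \<bullet> b)))"
      by (auto simp: algebra_simps)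
    moreover have "(\<lambda>x. (\<Prod>b\<in>insert b B. indicator (A b) (x \<bullet> b)) * cos (x \<bullet> s + c)) = 
      (\<lambda>x. w x * (cos (x \<bullet> s + c) * indicator (A b) (x \<bullet> b)))"
      using insert.hyps by (auto simp: w_def)
    ultimately show ?thesis by (simp only: Bochner_Integration.integral_add[OF i]) simp
  qed
  show ?case unfolding split[OF assms(1,3)] split[OF assms(2,4)] by (simp only: step[of 1] step[of 0] abs_one abs_zero)
qed

text \<open>At frequency and phase zero the cosine is 1, and the indicator of a box is a product of
  interval indicators over \<open>Basis\<close>. Hence the measures agree on open boxes, an
  intersection-stable generator of the Borel sets.\<close>

lemma cos_integrals_unique:
  fixes \<mu> \<nu> :: "'a::euclidean_space measure"
  assumes "prob_space \<mu>" "prob_space \<nu>" and sets_eq[measurable_cong]: "sets \<mu> = sets borel" "sets \<nu> = sets borel"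
    and eq: "\<And>s c. (\<integral>x. cos (x \<bullet> s + c) \<partial>\<mu>) = (\<integral>x. cos (x \<bullet> s + c) \<partial>\<nu>)"
  shows "\<mu> = \<nu>"
proof -
  interpret \<mu>: prob_space \<mu> by fact
  interpret \<nu>: prob_space \<nu> by fact
  have box: "emeasure \<mu> (box a b) = emeasure \<nu> (box a b)" for a b :: 'a
  proof -
    have ind: "(\<Prod>i\<in>Basis. indicator {a \<bullet> i<..<b \<bullet> i} (x \<bullet> i)) = (indicator (box a b) x :: real)" for x
    proof (cases "x \<in> box a b")
      case False
      then obtain i where "i \<in> Basis" "\<not> (a \<bullet> i < x \<bullet> i \<and> x \<bullet> i < b \<bullet> i)" by (auto simp: mem_box)
      then have "(\<Prod>i\<in>Basis. indicator {a \<bullet> i<..<b \<bullet> i} (x \<bullet> i)) = (0::real)"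
        by (intro prod_zero bexI[of _ i]) auto
      with False show ?thesis by simp
    qed (auto simp: mem_box intro!: prod.neutral)
    have "measure \<mu> (box a b) = measure \<nu> (box a b)"
      using cos_integrals_determine_boxes[OF assms finite_Basis, of "\<lambda>i. {a \<bullet> i<..<b \<bullet> i}" 0 0]
      by (simp add: ind sets_eq[THEN sets_eq_imp_space_eq])
    then show ?thesis by (simp add: \<mu>.emeasure_eq_measure \<nu>.emeasure_eq_measure)
  qed
  let ?E = "range (\<lambda>(a, b). box a b :: 'a set)"
  show ?thesis
  proof (rule measure_eqI_generator_eq)
    show "Int_stable ?E"
      by (fastforce simp: Int_stable_def box_Int_box)
    show "emeasure \<mu> X = emeasure \<nu> X" if "X \<in> ?E" for X
      using that box by auto
    show "sets \<mu> = sigma_sets UNIV ?E" "sets \<nu> = sigma_sets UNIV ?E"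
      by (simp_all add: sets_eq borel_eq_box)
    let ?A = "\<lambda>n::nat. box (- (real n *\<^sub>R One)) (real n *\<^sub>R One) :: 'a set"
    show "range ?A \<subseteq> ?E" "(\<Union>i. ?A i) = UNIV"
      unfolding UN_box_eq_UNIV by auto
  qed auto
qed

text \<open>Each wave \<open>cos (x \<bullet> s + c)\<close> depends on \<open>x\<close> only
  through the projection onto the direction of \<open>s\<close>, so its integral can be read off
  from \<open>radon\<close>.\<close>

lemma Cramer_Wold:
  fixes \<mu> \<nu> :: "'a::euclidean_space measure"
  assumes "prob_space \<mu>" "prob_space \<nu>" and sets_eq[measurable_cong]: "sets \<mu> = sets borel" "sets \<nu> = sets borel"
    and eq: "\<And>\<theta>. norm \<theta> = 1 \<Longrightarrow> radon \<mu> \<theta> = radon \<nu> \<theta>"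
  shows "\<mu> = \<nu>"
proof (rule cos_integrals_unique[OF assms(1-4)])
  fix s :: 'a and c :: real
  obtain \<theta> where \<theta>: "norm \<theta> = 1" "s = norm s *\<^sub>R \<theta>"
  proof (cases "s = 0")
    \<comment> \<open>The zero frequency has no direction of its own; any unit vector
      serves.\<close>
    case True
    then show ?thesis using that[of "SOME b. b \<in> Basis"] by (simp add: norm_some_Basis)
  next
    case False
    then show ?thesis using that[of "s /\<^sub>R norm s"] by simp
  qed
  have "(\<integral>x. cos (x \<bullet> s + c) \<partial>L) = (\<integral>y. cos (norm s * y + c) \<partial>radon L \<theta>)"
    if [measurable_cong]: "sets L = sets borel" for L
    unfolding radon_def by (subst integral_distr, measurable) (metis \<theta>(2) inner_scaleR_right)
  then show "(\<integral>x. cos (x \<bullet> s + c) \<partial>\<mu>) = (\<integral>x. cos (x \<bullet> s + c) \<partial>\<nu>)"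
    using eq[OF \<theta>(1)] sets_eq by simp
qed

subsection \<open>Energy of measures on the sphere\<close>

text \<open>With the second moment matrix \<open>m\<close>, the mean of
  \<open>(x \<bullet> y)\<^sup>2\<close> is the sum of all squared entries, hence at least the sum
  of the squared diagonal entries. The diagonal sums to 1, so Cauchy-Schwarz gives the bound
  \<open>1 / DIM('a)\<close>.\<close>

lemma MC_lower_bound:
  assumes "\<sigma> \<in> (MC C :: 'a::euclidean_space measure set)"
  shows "1 / DIM('a) \<le> C"
proof -
  have [measurable_cong]: "sets \<sigma> = sets borel" and "prob_space \<sigma>"
    and sphere: "emeasure \<sigma> (sphere 0 1) = 1"
    and C: "(\<integral>\<^sup>+ z. ennreal \<bar>fst z \<bullet> snd z\<bar> \<partial>(\<sigma> \<Otimes>\<^sub>M \<sigma>)) \<le> ennreal C"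
    using assms by (auto simp: MC_def)
  interpret prob_space \<sigma> by fact
  have AE: "AE x in \<sigma>. norm x = 1"
    using AE_prob_1[of "sphere 0 1"] sphere by (simp add: measure_def)
  define m where "m i j = (\<integral>x. (x \<bullet> i) * (x \<bullet> j) \<partial>\<sigma>)" for i j :: 'a
  have int: "integrable \<sigma> (\<lambda>x. (x \<bullet> i) * (x \<bullet> j))" if "i \<in> Basis" "j \<in> Basis" for i j
  proof (rule integrable_const_bound[of _ 1])
    show "AE x in \<sigma>. norm ((x \<bullet> i) * (x \<bullet> j)) \<le> 1"
      using AE
    proof eventually_elim
      case (elim x)
      then have "\<bar>x \<bullet> i\<bar> \<le> 1" "\<bar>x \<bullet> j\<bar> \<le> 1"
        using Basis_le_norm[of i x] Basis_le_norm[of j x] that by auto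
      then show ?case using mult_mono[of "\<bar>x \<bullet> i\<bar>" 1 "\<bar>x \<bullet> j\<bar>" 1] by (simp add: abs_mult)
    qed
  qed auto
  \<comment> \<open>Expanding in coordinates separates \<open>x\<close> from \<open>y\<close>, so
    the double integral becomes a sum of squares of entries of \<open>m\<close>.\<close>
  have sq: "(x \<bullet> y)\<^sup>2 = (\<Sum>i\<in>Basis. \<Sum>j\<in>Basis. ((x \<bullet> i) * (x \<bullet> j)) * ((y \<bullet> i) * (y \<bullet> j)))" for x y :: 'a
    unfolding euclidean_inner[of x y] power2_eq_square sum_product
    by (intro sum.cong refl) (simp add: mult_ac)
  have inner: "(\<integral>y. (x \<bullet> y)\<^sup>2 \<partial>\<sigma>) = (\<Sum>i\<in>Basis. \<Sum>j\<in>Basis. ((x \<bullet> i) * (x \<bullet> j)) * m i j)" for x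
    unfolding sq m_def by (simp add: int)
  have outer: "(\<integral>x. \<integral>y. (x \<bullet> y)\<^sup>2 \<partial>\<sigma> \<partial>\<sigma>) = (\<Sum>i\<in>Basis. \<Sum>j\<in>Basis. (m i j)\<^sup>2)"
    unfolding inner by (simp add: int m_def[symmetric] power2_eq_square)
  have trace: "(\<Sum>i\<in>Basis. m i i) = 1"
  proof -
    have "(\<Sum>i\<in>Basis. m i i) = (\<integral>x. (\<Sum>i\<in>Basis. (x \<bullet> i) * (x \<bullet> i)) \<partial>\<sigma>)"
      unfolding m_def by (simp add: int)
    also have "\<dots> = (\<integral>x. 1 \<partial>\<sigma>)"
      using AE by (intro integral_cong_AE) (auto simp flip: euclidean_inner power2_norm_eq_inner)
    finally show ?thesis by (simp add: prob_space)
  qed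
  have "1 / DIM('a) \<le> (\<Sum>i\<in>Basis. (m i i)\<^sup>2)"
    using sum_squared_le_sum_of_squares[of "\<lambda>i. m i i" Basis] by (simp add: trace divide_simps)
  also have "\<dots> \<le> (\<Sum>i\<in>Basis. \<Sum>j\<in>Basis. (m i j)\<^sup>2)"
    by (intro sum_mono member_le_sum) auto
  also have "\<dots> = (\<integral>x. \<integral>y. (x \<bullet> y)\<^sup>2 \<partial>\<sigma> \<partial>\<sigma>)" by (rule outer[symmetric])
  finally have "ennreal (1 / DIM('a)) \<le> ennreal (\<integral>x. \<integral>y. (x \<bullet> y)\<^sup>2 \<partial>\<sigma> \<partial>\<sigma>)" by (rule ennreal_leI)
  also have "\<dots> = (\<integral>\<^sup>+x. ennreal (\<integral>y. (x \<bullet> y)\<^sup>2 \<partial>\<sigma>) \<partial>\<sigma>)"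
  proof (rule nn_integral_eq_integral[symmetric])
    show "integrable \<sigma> (\<lambda>x. \<integral>y. (x \<bullet> y)\<^sup>2 \<partial>\<sigma>)"
      unfolding inner by (simp add: int)
  qed (rule AE_I2, rule Bochner_Integration.integral_nonneg, simp)
  also have "\<dots> = (\<integral>\<^sup>+x. \<integral>\<^sup>+y. ennreal ((x \<bullet> y)\<^sup>2) \<partial>\<sigma> \<partial>\<sigma>)"
  proof (intro nn_integral_cong nn_integral_eq_integral[symmetric])
    show "integrable \<sigma> (\<lambda>y. (x \<bullet> y)\<^sup>2)" for x
      unfolding sq by (simp add: int)
  qed simp
  also have "\<dots> \<le> (\<integral>\<^sup>+x. \<integral>\<^sup>+y. ennreal \<bar>x \<bullet> y\<bar> \<partial>\<sigma> \<partial>\<sigma>)"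
    using AE
  proof (intro nn_integral_mono_AE, eventually_elim)
    case (elim x)
    from AE show "(\<integral>\<^sup>+y. ennreal ((x \<bullet> y)\<^sup>2) \<partial>\<sigma>) \<le> (\<integral>\<^sup>+y. ennreal \<bar>x \<bullet> y\<bar> \<partial>\<sigma>)"
    proof (intro nn_integral_mono_AE, eventually_elim)
      fix y :: 'a assume "norm y = 1"
      then have "\<bar>x \<bullet> y\<bar> \<le> 1" using Cauchy_Schwarz_ineq2[of x y] elim by simp
      then have "\<bar>x \<bullet> y\<bar> * \<bar>x \<bullet> y\<bar> \<le> \<bar>x \<bullet> y\<bar> * 1" by (intro mult_left_mono) auto
      then show "ennreal ((x \<bullet> y)\<^sup>2) \<le> ennreal \<bar>x \<bullet> y\<bar>"
        by (intro ennreal_leI) (simp add: power2_eq_square abs_mult_self_eq)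
    qed
  qed
  also have "\<dots> = (\<integral>\<^sup>+ z. ennreal \<bar>fst z \<bullet> snd z\<bar> \<partial>(\<sigma> \<Otimes>\<^sub>M \<sigma>))"
    by (subst nn_integral_fst[symmetric]) auto
  finally have "ennreal (1 / DIM('a)) \<le> ennreal C" using C by simp
  \<comment> \<open>As \<open>1 / DIM('a)\<close> is positive, truncation by \<open>ennreal\<close>
    loses nothing here.\<close>
  then show ?thesis by (simp add: ennreal_le_iff2)
qed

text \<open>Only pairs of equal vectors have a nonzero inner product, so of all pairs just
  \<open>DIM('a)\<close> contribute to the energy, which is therefore \<open>1 / DIM('a)\<close>.
  The integral formula is proved first because the energy computation uses it.\<close>

lemma orthonormal_basis_in_MC:
  fixes S :: "'a::euclidean_space set"
  assumes "1 / DIM('a) \<le> C"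
    and S: "pairwise orthogonal S" "\<And>x. x \<in> S \<Longrightarrow> norm x = 1" "card S = DIM('a)"
  shows "distr (uniform_count_measure S) borel (\<lambda>x. x) \<in> MC C"
    and "\<And>f. f \<in> borel_measurable borel \<Longrightarrow>
      (\<integral>\<^sup>+x. f x \<partial>distr (uniform_count_measure S) borel (\<lambda>x. x)) = (\<Sum>x\<in>S. f x) * ennreal (1 / DIM('a))"
proof -
  let ?\<sigma> = "distr (uniform_count_measure S) borel (\<lambda>x. x)"
  \<comment> \<open>\<open>card\<close> is 0 on infinite sets and on the empty set, whereas the
    dimension is positive.\<close>
  have "finite S" "S \<noteq> {}" using S(3) card.infinite by fastforce+
  interpret U: prob_space "uniform_count_measure S"
    by (rule prob_space_uniform_count_measure) fact+
  have [measurable]: "(\<lambda>x. x) \<in> measurable (uniform_count_measure S) borel"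
    by (simp add: measurable_def space_uniform_count_measure sets_uniform_count_measure)
  interpret \<sigma>: prob_space ?\<sigma> by (rule U.prob_space_distr) simp
  show int: "(\<integral>\<^sup>+x. f x \<partial>?\<sigma>) = (\<Sum>x\<in>S. f x) * ennreal (1 / DIM('a))"
    if [measurable]: "f \<in> borel_measurable borel" for f :: "'a \<Rightarrow> ennreal"
  proof -
    have "(\<integral>\<^sup>+x. f x \<partial>?\<sigma>) = (\<integral>\<^sup>+x. f x \<partial>uniform_count_measure S)"
      by (simp add: nn_integral_distr)
    also have "\<dots> = (\<Sum>x\<in>S. ennreal (1 / DIM('a)) * f x)"
      using \<open>finite S\<close> S(3) by (simp add: uniform_count_measure_def nn_integral_point_measure_finite)
    finally show ?thesis unfolding sum_distrib_right by (simp only: mult.commute)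
  qed
  have diag: "(\<Sum>y\<in>S. ennreal \<bar>x \<bullet> y\<bar>) = 1" if "x \<in> S" for x
  proof -
    have "(\<Sum>y\<in>S. ennreal \<bar>x \<bullet> y\<bar>) = (\<Sum>y\<in>S. if y = x then 1 else 0)"
      using that S by (intro sum.cong refl)
        (auto simp: pairwise_def orthogonal_def norm_eq_1)
    then show ?thesis using that \<open>finite S\<close> by simp
  qed
  have "(\<integral>\<^sup>+ z. ennreal \<bar>fst z \<bullet> snd z\<bar> \<partial>(?\<sigma> \<Otimes>\<^sub>M ?\<sigma>)) = (\<integral>\<^sup>+x. \<integral>\<^sup>+y. ennreal \<bar>x \<bullet> y\<bar> \<partial>?\<sigma> \<partial>?\<sigma>)"
    by (subst \<sigma>.nn_integral_fst[symmetric]) auto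
  also have "\<dots> = (\<Sum>x\<in>S. (\<Sum>y\<in>S. ennreal \<bar>x \<bullet> y\<bar>) * ennreal (1 / DIM('a))) * ennreal (1 / DIM('a))"
    by (subst int) (auto simp: int)
  also have "\<dots> = ennreal (1 / DIM('a))"
    using diag S(3) by (simp add: ennreal_of_nat_eq_real_of_nat flip: ennreal_mult)
  also have "\<dots> \<le> ennreal C" using assms(1) by (rule ennreal_leI)
  finally have "(\<integral>\<^sup>+ z. ennreal \<bar>fst z \<bullet> snd z\<bar> \<partial>(?\<sigma> \<Otimes>\<^sub>M ?\<sigma>)) \<le> ennreal C" .
  moreover have "emeasure ?\<sigma> (sphere 0 1) = 1"
  proof -
    have "emeasure ?\<sigma> (sphere 0 1) = emeasure (uniform_count_measure S) (space (uniform_count_measure S))"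
      using S(2) by (subst emeasure_distr)
        (auto simp: space_uniform_count_measure intro!: arg_cong[of _ _ "emeasure (uniform_count_measure S)"])
    then show ?thesis by (simp add: U.emeasure_space_1)
  qed
  ultimately show "?\<sigma> \<in> MC C"
    by (simp add: MC_def \<sigma>.prob_space_axioms)
qed

subsection \<open>The distributional sliced-Wasserstein distance\<close>

lemma prob_space_radon:
  assumes "\<mu> \<in> Pp p"
  shows "prob_space (radon \<mu> \<theta>)"
proof -
  have [measurable_cong]: "sets \<mu> = sets borel" and "prob_space \<mu>" using assms by (auto simp: Pp_def)
  then show ?thesis unfolding radon_def by (intro prob_space.prob_space_distr) auto
qed

lemma sets_radon [simp]: "sets (radon \<mu> \<theta>) = sets borel"
  by (simp add: radon_def)

definition Lp_norm :: "real \<Rightarrow> 'a::euclidean_space measure \<Rightarrow> real" where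
  "Lp_norm p \<mu> = ennroot p (\<integral>\<^sup>+x. ennreal (norm x powr p) \<partial>\<mu>)"

text \<open>Projecting the same random point in both directions couples the two projections, and
  Cauchy-Schwarz bounds the displacement. Thus \<open>Lp_norm p \<mu>\<close> is a Lipschitz
  constant in the direction.\<close>

lemma Wpp_radon_radon_le:
  assumes "p \<ge> 1" "\<mu> \<in> Pp p"
  shows "Wpp p (radon \<mu> \<theta>) (radon \<mu> \<theta>') \<le> ennreal ((norm (\<theta> - \<theta>') * Lp_norm p \<mu>) powr p)"
proof -
  have [measurable_cong]: "sets \<mu> = sets borel" and "prob_space \<mu>"
    and fin: "(\<integral>\<^sup>+x. ennreal (norm x powr p) \<partial>\<mu>) < \<infinity>" using assms by (auto simp: Pp_def)
  have "Wpp p (radon \<mu> \<theta>) (radon \<mu> \<theta>') \<le> (\<integral>\<^sup>+x. ennreal (\<bar>x \<bullet> \<theta> - x \<bullet> \<theta>'\<bar> powr p) \<partial>\<mu>)"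
    unfolding radon_def by (rule Wpp_distr_le) (use \<open>prob_space \<mu>\<close> in auto)
  also have "\<dots> \<le> (\<integral>\<^sup>+x. ennreal (norm (\<theta> - \<theta>') powr p) * ennreal (norm x powr p) \<partial>\<mu>)"
  proof (intro nn_integral_mono)
    fix x
    have "\<bar>x \<bullet> \<theta> - x \<bullet> \<theta>'\<bar> \<le> norm (\<theta> - \<theta>') * norm x"
      using Cauchy_Schwarz_ineq2[of x "\<theta> - \<theta>'"] by (simp add: inner_diff_right mult.commute)
    then have "\<bar>x \<bullet> \<theta> - x \<bullet> \<theta>'\<bar> powr p \<le> (norm (\<theta> - \<theta>') * norm x) powr p"
      using \<open>p \<ge> 1\<close> by (intro powr_mono2) auto
    then show "ennreal (\<bar>x \<bullet> \<theta> - x \<bullet> \<theta>'\<bar> powr p) \<le> ennreal (norm (\<theta> - \<theta>') powr p) * ennreal (norm x powr p)"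
      by (simp add: powr_mult flip: ennreal_mult)
  qed
  also have "\<dots> = ennreal (norm (\<theta> - \<theta>') powr p) * ennreal (Lp_norm p \<mu> powr p)"
    unfolding Lp_norm_def ennroot_powr[OF assms(1) fin] by (simp add: nn_integral_cmult)
  also have "\<dots> = ennreal ((norm (\<theta> - \<theta>') * Lp_norm p \<mu>) powr p)"
    by (simp add: powr_mult Lp_norm_def flip: ennreal_mult)
  finally show ?thesis .
qed

lemma Lp_norm_nonneg [simp]: "Lp_norm p \<mu> \<ge> 0"
  by (simp add: Lp_norm_def)

lemma radon_0:
  assumes "\<mu> \<in> Pp p"
  shows "radon \<mu> 0 = return borel 0"
proof -
  interpret prob_space \<mu> using assms by (simp add: Pp_def)
  show ?thesis by (simp add: radon_def)
qed

lemma
  assumes "p \<ge> 1" "\<mu> \<in> Pp p"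
  shows Wpp_radon_radon_finite: "Wpp p (radon \<mu> \<theta>) (radon \<mu> \<theta>') < \<infinity>"
    and ennroot_Wpp_radon_radon_le: "ennroot p (Wpp p (radon \<mu> \<theta>) (radon \<mu> \<theta>')) \<le> norm (\<theta> - \<theta>') * Lp_norm p \<mu>"
proof -
  note le = Wpp_radon_radon_le[OF assms, of \<theta> \<theta>']
  show "Wpp p (radon \<mu> \<theta>) (radon \<mu> \<theta>') < \<infinity>"
    by (rule le_less_trans[OF le]) simp
  show "ennroot p (Wpp p (radon \<mu> \<theta>) (radon \<mu> \<theta>')) \<le> norm (\<theta> - \<theta>') * Lp_norm p \<mu>"
    using assms le by (intro ennroot_le) auto
qed

context
  fixes p :: real and \<mu> \<nu> :: "'a::euclidean_space measure"
  assumes p: "p \<ge> 1" and \<mu>: "\<mu> \<in> Pp p" and \<nu>: "\<nu> \<in> Pp p"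
begin

text \<open>All projections onto the direction \<open>0\<close> are the Dirac measure at \<open>0\<close>, so going through it
  bounds the sliced distance.\<close>

lemma
  shows Wpp_radon_finite: "Wpp p (radon \<mu> \<theta>) (radon \<nu> \<theta>) < \<infinity>"
    and ennroot_Wpp_radon_le: "ennroot p (Wpp p (radon \<mu> \<theta>) (radon \<nu> \<theta>)) \<le> norm \<theta> * (Lp_norm p \<mu> + Lp_norm p \<nu>)"
proof -
  have z: "radon \<mu> 0 = radon \<nu> 0" using \<mu> \<nu> by (simp add: radon_0)
  note f = Wpp_radon_radon_finite[OF p \<mu>, of \<theta> 0] Wpp_radon_radon_finite[OF p \<nu>, of 0 \<theta>]
  show "Wpp p (radon \<mu> \<theta>) (radon \<nu> \<theta>) < \<infinity>"
    using Wpp_triangle(1)[OF p f(1)[unfolded z] f(2)] .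
  show "ennroot p (Wpp p (radon \<mu> \<theta>) (radon \<nu> \<theta>)) \<le> norm \<theta> * (Lp_norm p \<mu> + Lp_norm p \<nu>)"
    using Wpp_triangle(2)[OF p f(1)[unfolded z] f(2)]
      ennroot_Wpp_radon_radon_le[OF p \<mu>, of \<theta> 0] ennroot_Wpp_radon_radon_le[OF p \<nu>, of 0 \<theta>]
    by (simp add: z distrib_left)
qed

text \<open>Changing the direction in one measure at a time, two triangle inequalities give a
  Lipschitz bound with constant \<open>L\<close>. Continuity is what makes the integrand measurable
  in the direction.\<close>

lemma ennroot_Wpp_radon_continuous:
  "continuous_on UNIV (\<lambda>\<theta>. ennroot p (Wpp p (radon \<mu> \<theta>) (radon \<nu> \<theta>)))"
proof -
  define w where "w \<theta> = ennroot p (Wpp p (radon \<mu> \<theta>) (radon \<nu> \<theta>))" for \<theta>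
  define L where "L = Lp_norm p \<mu> + Lp_norm p \<nu>"
  have le: "w \<theta> \<le> w \<theta>' + norm (\<theta> - \<theta>') * L" for \<theta> \<theta>'
  proof -
    note f1 = Wpp_radon_radon_finite[OF p \<mu>, of \<theta> \<theta>'] and f2 = Wpp_radon_radon_finite[OF p \<nu>, of \<theta>' \<theta>]
    have "w \<theta> \<le> ennroot p (Wpp p (radon \<mu> \<theta>) (radon \<mu> \<theta>')) + ennroot p (Wpp p (radon \<mu> \<theta>') (radon \<nu> \<theta>))"
      unfolding w_def by (intro Wpp_triangle(2)[OF p f1] Wpp_triangle(1)[OF p _ f2] Wpp_radon_finite)
    also have "ennroot p (Wpp p (radon \<mu> \<theta>') (radon \<nu> \<theta>)) \<le> w \<theta>' + ennroot p (Wpp p (radon \<nu> \<theta>') (radon \<nu> \<theta>))"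
      unfolding w_def by (intro Wpp_triangle(2)[OF p _ f2] Wpp_radon_finite)
    finally show ?thesis
      using ennroot_Wpp_radon_radon_le[OF p \<mu>, of \<theta> \<theta>'] ennroot_Wpp_radon_radon_le[OF p \<nu>, of \<theta>' \<theta>]
      by (simp add: L_def distrib_left norm_minus_commute)
  qed
  have "L-lipschitz_on UNIV w"
  proof (rule lipschitz_onI)
    fix \<theta> \<theta>'
    show "dist (w \<theta>) (w \<theta>') \<le> L * dist \<theta> \<theta>'"
      using le[of \<theta> \<theta>'] le[of \<theta>' \<theta>] by (simp add: dist_norm abs_le_iff norm_minus_commute mult.commute)
  qed (simp add: L_def)
  then show ?thesis unfolding w_def by (rule lipschitz_on_continuous_on)
qed

lemma ennroot_Wpp_radon_measurable [measurable]:
  "(\<lambda>\<theta>. ennroot p (Wpp p (radon \<mu> \<theta>) (radon \<nu> \<theta>))) \<in> borel_measurable borel"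
  by (rule borel_measurable_continuous_onI[OF ennroot_Wpp_radon_continuous])

lemma Wpp_radon_eq: "Wpp p (radon \<mu> \<theta>) (radon \<nu> \<theta>) = ennreal (ennroot p (Wpp p (radon \<mu> \<theta>) (radon \<nu> \<theta>)) powr p)"
  by (simp only: ennroot_powr[OF p Wpp_radon_finite])

lemma Wpp_radon_measurable: "(\<lambda>\<theta>. Wpp p (radon \<mu> \<theta>) (radon \<nu> \<theta>)) \<in> borel_measurable borel"
  by (subst Wpp_radon_eq) measurable

text \<open>On unit vectors the projected distance has a bound independent of the direction, hence
  also of \<open>\<sigma>\<close>.\<close>

lemma DSWpp_finite: "DSWpp p C \<mu> \<nu> < \<infinity>"
proof -
  have "(\<integral>\<^sup>+\<theta>. Wpp p (radon \<mu> \<theta>) (radon \<nu> \<theta>) \<partial>\<sigma>) \<le> ennreal ((Lp_norm p \<mu> + Lp_norm p \<nu>) powr p)"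
    if \<sigma>: "\<sigma> \<in> MC C" for \<sigma>
  proof -
    have "prob_space \<sigma>" and sphere: "emeasure \<sigma> (sphere 0 1) = 1" using \<sigma> by (auto simp: MC_def)
    interpret \<sigma>: prob_space \<sigma> by fact
    have "AE \<theta> in \<sigma>. \<theta> \<in> sphere 0 1"
      using sphere by (intro \<sigma>.AE_prob_1) (simp add: measure_def)
    then have "(\<integral>\<^sup>+\<theta>. Wpp p (radon \<mu> \<theta>) (radon \<nu> \<theta>) \<partial>\<sigma>) \<le> (\<integral>\<^sup>+\<theta>. ennreal ((Lp_norm p \<mu> + Lp_norm p \<nu>) powr p) \<partial>\<sigma>)"
    proof (intro nn_integral_mono_AE, eventually_elim)
      fix \<theta> :: 'a assume "\<theta> \<in> sphere 0 1"
      then show "Wpp p (radon \<mu> \<theta>) (radon \<nu> \<theta>) \<le> ennreal ((Lp_norm p \<mu> + Lp_norm p \<nu>) powr p)"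
        using ennroot_Wpp_radon_le[of \<theta>] by (intro le_ennreal_powr[OF p Wpp_radon_finite]) simp
    qed
    then show ?thesis by (simp add: \<sigma>.emeasure_space_1)
  qed
  then have "DSWpp p C \<mu> \<nu> \<le> ennreal ((Lp_norm p \<mu> + Lp_norm p \<nu>) powr p)"
    unfolding DSWpp_def by (rule SUP_least)
  then show ?thesis by (rule le_less_trans) simp
qed

text \<open>Complete \<open>\<theta>\<close> to an orthonormal basis. Its uniform measure belongs to
  \<open>MC C\<close>, because nonemptiness forces \<open>1 / DIM('a) \<le> C\<close>, and it gives
  \<open>\<theta>\<close> the weight \<open>1 / DIM('a)\<close>.\<close>

lemma Wpp_radon_le_DSWpp:
  assumes "(MC C :: 'a measure set) \<noteq> {}" "norm \<theta> = 1"
  shows "Wpp p (radon \<mu> \<theta>) (radon \<nu> \<theta>) * ennreal (1 / DIM('a)) \<le> DSWpp p C \<mu> \<nu>"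
proof -
  obtain S where S: "\<theta> \<in> S" "pairwise orthogonal S" "\<And>x. x \<in> S \<Longrightarrow> norm x = 1" "card S = DIM('a)"
    using vector_in_orthonormal_basis[OF assms(2)] by metis
  have "finite S" using S(4) card.infinite by fastforce
  have C: "1 / DIM('a) \<le> C" using MC_lower_bound assms(1) by blast
  have "Wpp p (radon \<mu> \<theta>) (radon \<nu> \<theta>) \<le> (\<Sum>x\<in>S. Wpp p (radon \<mu> x) (radon \<nu> x))"
    using S(1) \<open>finite S\<close> by (intro member_le_sum) auto
  then have "Wpp p (radon \<mu> \<theta>) (radon \<nu> \<theta>) * ennreal (1 / DIM('a)) \<le>
      (\<Sum>x\<in>S. Wpp p (radon \<mu> x) (radon \<nu> x)) * ennreal (1 / DIM('a))"
    by (intro mult_right_mono) auto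
  also have "\<dots> = (\<integral>\<^sup>+x. Wpp p (radon \<mu> x) (radon \<nu> x) \<partial>distr (uniform_count_measure S) borel (\<lambda>x. x))"
    by (rule orthonormal_basis_in_MC(2)[OF C S(2-4) Wpp_radon_measurable, symmetric])
  also have "\<dots> \<le> DSWpp p C \<mu> \<nu>"
    unfolding DSWpp_def by (rule SUP_upper) (rule orthonormal_basis_in_MC(1)[OF C S(2-4)])
  finally show ?thesis .
qed

text \<open>If the supremum vanishes, the weight \<open>1 / DIM('a)\<close> on each unit direction
  forces every projected distance to vanish, so all projections agree.\<close>

lemma DSWpp_eq_0_iff:
  assumes "(MC C :: 'a measure set) \<noteq> {}"
  shows "DSWpp p C \<mu> \<nu> = 0 \<longleftrightarrow> \<mu> = \<nu>"
proof
  assume zero: "DSWpp p C \<mu> \<nu> = 0"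
  show "\<mu> = \<nu>"
  proof (rule Cramer_Wold)
    fix \<theta> :: 'a assume \<theta>: "norm \<theta> = 1"
    have "Wpp p (radon \<mu> \<theta>) (radon \<nu> \<theta>) = 0"
      using Wpp_radon_le_DSWpp[OF assms \<theta>] zero by simp
    then show "radon \<mu> \<theta> = radon \<nu> \<theta>"
      using p \<mu> \<nu> by (intro Wpp_eq_0_imp_eq) (auto intro: prob_space_radon)
  qed (use \<mu> \<nu> in \<open>auto simp: Pp_def\<close>)
next
  assume "\<mu> = \<nu>"
  then have "Wpp p (radon \<mu> \<theta>) (radon \<nu> \<theta>) = 0" for \<theta>
    using \<mu> by (auto intro: Wpp_self prob_space_radon)
  then show "DSWpp p C \<mu> \<nu> = 0"
    using assms by (simp add: DSWpp_def)
qed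

end

section \<open>Triangle inequality, symmetry and the metric axioms\<close>

lemma DSW_eq_ennroot: "DSW p C \<mu> \<nu> = ennroot p (DSWpp p C \<mu> \<nu>)"
  by (simp add: DSW_def ennroot_def)

text \<open>For a fixed \<open>\<sigma>\<close>, the triangle inequality in every direction combines
  with Minkowski's inequality in \<open>L^p\<close> of \<open>\<sigma>\<close>; the supremum is
  taken afterwards.\<close>

lemma DSW_triangle:
  fixes \<mu> \<nu> \<eta> :: "'a::euclidean_space measure"
  assumes p: "p \<ge> 1" and \<mu>: "\<mu> \<in> Pp p" and \<nu>: "\<nu> \<in> Pp p" and \<eta>: "\<eta> \<in> Pp p"
  shows "DSW p C \<mu> \<nu> \<le> DSW p C \<mu> \<eta> + DSW p C \<eta> \<nu>"
proof (rule field_le_epsilon)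
  fix d :: real assume "d > 0"
  \<comment> \<open>The slack \<open>d / 2\<close> makes both bounds strictly positive, as required
    by \<open>nn_integral_Minkowski\<close>.\<close>
  define a where "a = DSW p C \<mu> \<eta> + d / 2"
  define b where "b = DSW p C \<eta> \<nu> + d / 2"
  have ab: "a > 0" "b > 0"
    using \<open>d > 0\<close> by (auto simp: a_def b_def DSW_eq_ennroot intro: add_nonneg_pos)
  have DSWpp: "DSWpp p C \<mu> \<eta> \<le> ennreal (a powr p)" "DSWpp p C \<eta> \<nu> \<le> ennreal (b powr p)"
    using \<open>d > 0\<close> by (auto intro!: le_ennreal_powr[OF p] DSWpp_finite[OF p, unfolded infinity_ennreal_def] \<mu> \<nu> \<eta> simp: a_def b_def DSW_eq_ennroot)
  define f where "f \<theta> = ennroot p (Wpp p (radon \<mu> \<theta>) (radon \<eta> \<theta>))" for \<theta>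
  define g where "g \<theta> = ennroot p (Wpp p (radon \<eta> \<theta>) (radon \<nu> \<theta>))" for \<theta>
  have [measurable]: "f \<in> borel_measurable borel" "g \<in> borel_measurable borel"
    unfolding f_def g_def
    by (rule ennroot_Wpp_radon_measurable[OF p \<mu> \<eta>]) (rule ennroot_Wpp_radon_measurable[OF p \<eta> \<nu>])
  have f: "ennreal (f \<theta> powr p) = Wpp p (radon \<mu> \<theta>) (radon \<eta> \<theta>)"
    and g: "ennreal (g \<theta> powr p) = Wpp p (radon \<eta> \<theta>) (radon \<nu> \<theta>)" for \<theta>
    unfolding f_def g_def
    by (rule ennroot_powr[OF p Wpp_radon_finite[OF p \<mu> \<eta>]]) (rule ennroot_powr[OF p Wpp_radon_finite[OF p \<eta> \<nu>]])
  have "(\<integral>\<^sup>+\<theta>. Wpp p (radon \<mu> \<theta>) (radon \<nu> \<theta>) \<partial>\<sigma>) \<le> ennreal ((a + b) powr p)"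
    if \<sigma>: "\<sigma> \<in> MC C" for \<sigma>
  proof -
    have [measurable_cong]: "sets \<sigma> = sets borel" using \<sigma> by (simp add: MC_def)
    have "(\<integral>\<^sup>+\<theta>. Wpp p (radon \<mu> \<theta>) (radon \<nu> \<theta>) \<partial>\<sigma>) \<le> (\<integral>\<^sup>+\<theta>. ennreal ((f \<theta> + g \<theta>) powr p) \<partial>\<sigma>)"
      unfolding f_def g_def
      by (intro nn_integral_mono le_ennreal_powr Wpp_triangle(2) Wpp_radon_finite p \<mu> \<nu> \<eta>)
    also have "\<dots> \<le> ennreal ((a + b) powr p)"
    proof (rule nn_integral_Minkowski[OF p _ _ _ _ ab])
      show "(\<integral>\<^sup>+\<theta>. ennreal (f \<theta> powr p) \<partial>\<sigma>) \<le> ennreal (a powr p)"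
        unfolding f using DSWpp(1) SUP_upper[OF \<sigma>] unfolding DSWpp_def by (metis (no_types, lifting) order_trans)
      show "(\<integral>\<^sup>+\<theta>. ennreal (g \<theta> powr p) \<partial>\<sigma>) \<le> ennreal (b powr p)"
        unfolding g using DSWpp(2) SUP_upper[OF \<sigma>] unfolding DSWpp_def by (metis (no_types, lifting) order_trans)
      show "f \<in> borel_measurable \<sigma>" "g \<in> borel_measurable \<sigma>" by measurable
    qed (simp_all add: f_def g_def)
    finally show ?thesis .
  qed
  \<comment> \<open>The bound is uniform in \<open>\<sigma>\<close>, so it passes to the
    supremum.\<close>
  then have "DSWpp p C \<mu> \<nu> \<le> ennreal ((a + b) powr p)"
    unfolding DSWpp_def by (rule SUP_least)
  then have "DSW p C \<mu> \<nu> \<le> a + b"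
    unfolding DSW_eq_ennroot using p ab by (intro ennroot_le) auto
  then show "DSW p C \<mu> \<nu> \<le> DSW p C \<mu> \<eta> + DSW p C \<eta> \<nu> + d" by (simp add: a_def b_def)
qed

lemma DSWpp_commute: "DSWpp p C \<mu> \<nu> = DSWpp p C \<nu> \<mu>"
  unfolding DSWpp_def by (subst Wpp_commute) (rule refl)

theorem theorem1:
  fixes p C :: real
  assumes "DIM('a::euclidean_space) \<ge> 2"
    and "p \<ge> 1"
    and "C > 0"
    and "(MC C :: 'a measure set) \<noteq> {}"
  shows "\<forall>\<mu>\<in>(Pp p :: 'a measure set). \<forall>\<nu>\<in>Pp p. \<forall>\<eta>\<in>Pp p.
           DSWpp p C \<mu> \<nu> < \<infinity> \<and>
           DSW p C \<mu> \<nu> \<ge> 0 \<and>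
           DSW p C \<mu> \<nu> = DSW p C \<nu> \<mu> \<and>
           (DSW p C \<mu> \<nu> = 0 \<longleftrightarrow> \<mu> = \<nu>) \<and>
           DSW p C \<mu> \<nu> \<le> DSW p C \<mu> \<eta> + DSW p C \<eta> \<nu>"
proof (intro ballI conjI)
  fix \<mu> \<nu> \<eta> :: "'a measure"
  assume \<mu>: "\<mu> \<in> Pp p" and \<nu>: "\<nu> \<in> Pp p" and \<eta>: "\<eta> \<in> Pp p"
  \<comment> \<open>This is the well-definedness: \<open>enn2real\<close> would send an infinite
    supremum to 0. It also makes a vanishing root equivalent to a vanishing supremum.\<close>
  show fin: "DSWpp p C \<mu> \<nu> < \<infinity>"
    using assms(2) \<mu> \<nu> by (rule DSWpp_finite)
  show "DSW p C \<mu> \<nu> \<ge> 0"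
    by (simp add: DSW_eq_ennroot)
  show "DSW p C \<mu> \<nu> = DSW p C \<nu> \<mu>"
    by (simp only: DSW_eq_ennroot DSWpp_commute[of p C \<mu> \<nu>])
  show "DSW p C \<mu> \<nu> = 0 \<longleftrightarrow> \<mu> = \<nu>"
    unfolding DSW_eq_ennroot ennroot_eq_0_iff[OF assms(2) fin]
    by (rule DSWpp_eq_0_iff[OF assms(2) \<mu> \<nu> assms(4)])
  show "DSW p C \<mu> \<nu> \<le> DSW p C \<mu> \<eta> + DSW p C \<eta> \<nu>"
    using assms(2) \<mu> \<nu> \<eta> by (rule DSW_triangle)
qed

end
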